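(* Let $f(n)$, $n\in\mathbb{N}$, be a real sequence such that $|f(n)-f(m)|\gg 1$ for all $n\neq m$, and such that for some real $\tau>0$ and all sufficiently large $N$, $$\frac1N\sum_{n=1}^N|f(n)|\ll N^{\tau}.$$ Then for every real $\alpha\in(1/2,1)$, $$\dim\mathcal{F}_{f,\alpha}\leqslant 1-\frac{2\alpha-1}{\tau+1-\alpha},$$ where $\dim$ denotes Hausdorff dimension.
   Context: Write $\mathbf{e}(z)=\exp(2\pi i z)$ and $\mathsf{T}=[0,1]$. For a real sequence $f(n)$, $x\in\mathsf{T}$ and $N\in\mathbb{N}$ let $V_f(x;N)=\sum_{n=1}^N\mathbf{e}(xf(n))$, and for $\alpha\in(1/2,1)$ let $\mathcal{F}_{f,\alpha}=\{x\in\mathsf{T}:\ |V_f(x;N)|\geqslant N^\alpha\text{ for infinitely many }N\in\mathbb{N}\}$. The notation $U\ll V$ means $|U|\leqslant cV$ for some constant $c>0$ independent of the varying parameters. *)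

theory Defs
  imports "HOL-Analysis.Analysis"
begin

text \<open>
  The summand of the Hausdorff premeasure. It is the \<open>s\<close>-th power of the diameter with the
  convention \<open>0\<^sup>0 = 1\<close> for nonempty sets (note that \<open>0 powr 0 = 0\<close> in the library); the
  empty set contributes nothing, so finite covers may be padded by empty sets.
\<close>

definition hausdorff_gauge :: "real \<Rightarrow> 'a::metric_space set \<Rightarrow> ennreal" where
  "hausdorff_gauge s U =
     (if U = {} then 0 else if s = 0 then 1 else ennreal (diameter U powr s))"

text \<open>Boundedness of the covering sets is required because \<^const>\<open>diameter\<close> is real-valued
  and meaningless on unbounded sets.\<close>

definition hausdorff_premeasure :: "real \<Rightarrow> real \<Rightarrow> 'a::metric_space set \<Rightarrow> ennreal" where
  "hausdorff_premeasure s \<delta> A =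
     (INF U \<in> {U :: nat \<Rightarrow> 'a set. A \<subseteq> (\<Union>i. U i) \<and> (\<forall>i. bounded (U i) \<and> diameter (U i) \<le> \<delta>)}.
        \<Sum>i. hausdorff_gauge s (U i))"

definition hausdorff_measure :: "real \<Rightarrow> 'a::metric_space set \<Rightarrow> ennreal" where
  "hausdorff_measure s A = (SUP \<delta> \<in> {0<..}. hausdorff_premeasure s \<delta> A)"

definition hausdorff_dim :: "'a::metric_space set \<Rightarrow> ereal" where
  "hausdorff_dim A = Inf (ereal ` {s. 0 \<le> s \<and> hausdorff_measure s A = 0})"

definition e_char :: "complex \<Rightarrow> complex" where
  "e_char z = exp (2 * of_real pi * \<i> * z)"

definition exp_sum :: "(nat \<Rightarrow> real) \<Rightarrow> real \<Rightarrow> nat \<Rightarrow> complex" where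
  "exp_sum f x N = (\<Sum>n=1..N. e_char (of_real (x * f n)))"

definition large_sums_set :: "(nat \<Rightarrow> real) \<Rightarrow> real \<Rightarrow> real set" where
  "large_sums_set f \<alpha> =
     {x \<in> {0..1}. \<exists>\<^sub>\<infinity>N. cmod (exp_sum f x N) \<ge> real N powr \<alpha>}"

end

theory Submission imports Defs begin

text \<open>
  Let \<open>\<beta> = \<tau> + 1 - \<alpha>\<close>. For \<open>N \<approx> 2\<^sup>i\<close> the sum \<open>V(x; N)\<close> is Lipschitz in \<open>x\<close> with a constant of order
  \<open>2\<close> to the power \<open>i (\<tau> + 1)\<close>, so if it is at least \<open>N\<close> to the power \<open>\<alpha>\<close> at a point, it is at
  least half as large on a cell of length \<open>2\<close> to the power \<open>-i \<beta>\<close> around that point. A separated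
  sequence satisfies the mean value bound \<open>\<integral>\<bar>V\<bar>\<^sup>2 \<le> C N\<close>, which a dyadic decomposition upgrades, up to powers
  of \<open>i\<close>, to the maximum over all \<open>N < 2\<^sup>i\<close>. Chebyshev's inequality then bounds the number of such
  cells by \<open>2\<close> to the power \<open>i (1 - 2 \<alpha> + \<beta>)\<close>, up to powers of \<open>i\<close>, and these cells form
  the covers that make the \<open>s\<close>-dimensional Hausdorff measure vanish as soon as
  \<open>1 - 2 \<alpha> + \<beta> - s \<beta> < 0\<close>.
\<close>

section \<open>Hausdorff measure of limsup sets\<close>

text \<open>A Borel-Cantelli argument: each point of \<open>A\<close> lies in sets of arbitrarily
  late families, so all families from index \<open>m\<close> on still cover \<open>A\<close>, and
  their total gauge is bounded by a tail of the convergent series of \<open>b\<close>.\<close>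

lemma hausdorff_measure_limsup_eq_0:
  fixes A :: "'a::metric_space set" and V :: "nat \<Rightarrow> nat \<Rightarrow> 'a set"
  assumes cover: "\<And>x. x \<in> A \<Longrightarrow> \<exists>\<^sub>\<infinity>i. \<exists>k. x \<in> V i k"
    and bdd: "\<And>i k. bounded (V i k)"
    and diam: "\<And>i k. diameter (V i k) \<le> \<delta> i"
    and lim: "\<delta> \<longlonglongrightarrow> 0"
    and gauge: "\<forall>\<^sub>F i in sequentially. (\<Sum>k. hausdorff_gauge s (V i k)) \<le> ennreal (b i)"
    and b: "summable b" "\<And>i. 0 \<le> b i"
  shows "hausdorff_measure s A = 0"
proof -
  have "hausdorff_premeasure s d A \<le> 0 + ennreal e" if d: "0 < d" and e: "0 < e" for d e
  proof -
    have "\<forall>\<^sub>F i in sequentially. \<delta> i < d"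
      using order_tendstoD(2)[OF lim d] .
    with gauge obtain i1 where i1: "\<And>i. i \<ge> i1 \<Longrightarrow> \<delta> i < d"
      "\<And>i. i \<ge> i1 \<Longrightarrow> (\<Sum>k. hausdorff_gauge s (V i k)) \<le> ennreal (b i)"
      unfolding eventually_sequentially by (metis nle_le order_trans)
    obtain i2 where i2: "\<And>n. n \<ge> i2 \<Longrightarrow> norm (\<Sum>i. b (i + n)) < e"
      using suminf_exist_split[OF e b(1)] by blast
    define m where "m = max i1 i2"
    \<comment> \<open>The premeasure asks for a cover indexed by \<open>nat\<close>, so the pairs of
      family and member are enumerated through \<open>prod_decode\<close>.\<close>
    define U where "U = (\<lambda>(i, k). V (i + m) k)"
    have "A \<subseteq> (\<Union>n. U (prod_decode n))"
    proof
      fix x assume "x \<in> A"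
      from cover[OF this] obtain i k where "i \<ge> m" "x \<in> V i k"
        unfolding INFM_nat_le by blast
      then have "x \<in> U (prod_decode (prod_encode (i - m, k)))"
        by (simp add: U_def)
      then show "x \<in> (\<Union>n. U (prod_decode n))" by blast
    qed
    moreover have "bounded (U p) \<and> diameter (U p) \<le> d" for p
    proof (cases p)
      case (Pair i k)
      then show ?thesis
        using bdd diam[of "i + m" k] i1(1)[of "i + m"] by (force simp: U_def m_def)
    qed
    ultimately have "hausdorff_premeasure s d A \<le> (\<Sum>n. hausdorff_gauge s (U (prod_decode n)))"
      unfolding hausdorff_premeasure_def by (intro INF_lower) auto
    also have "\<dots> = (\<Sum>i. \<Sum>k. hausdorff_gauge s (V (i + m) k))"
      by (rule suminf_ennreal_2dimen[of _ "\<lambda>p. hausdorff_gauge s (U p)"]) (simp add: U_def)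
    also have "\<dots> \<le> (\<Sum>i. ennreal (b (i + m)))"
      by (intro suminf_le i1(2)) (auto simp: m_def)
    also have "\<dots> = ennreal (\<Sum>i. b (i + m))"
      using b by (intro suminf_ennreal2) (auto simp: summable_iff_shift)
    also have "\<dots> \<le> ennreal e"
      using i2[of m] by (intro ennreal_leI) (auto simp: m_def)
    finally show ?thesis by simp
  qed
  then have "hausdorff_premeasure s d A = 0" if "0 < d" for d
    using that ennreal_le_epsilon[of 0 "hausdorff_premeasure s d A"] by force
  then show ?thesis
    unfolding hausdorff_measure_def by (intro SUP_eq_const) (auto intro: exI[of _ 1])
qed

text \<open>Exponents close to \<open>t\<close> decide the infimum, and \<open>0 \<le> t\<close>
  makes them admissible. The ceiling \<open>u\<close> lets the measure estimate be restricted to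
  exponents below \<open>1\<close> later on.\<close>

lemma hausdorff_dim_le:
  assumes "0 \<le> t" "t < u"
    and "\<And>s. t < s \<Longrightarrow> s < u \<Longrightarrow> hausdorff_measure s A = 0"
  shows "hausdorff_dim A \<le> ereal t"
proof (rule ccontr)
  assume "\<not> hausdorff_dim A \<le> ereal t"
  then have "ereal t < min (hausdorff_dim A) (ereal u)"
    using assms by simp
  then obtain s where s: "ereal t < ereal s" "ereal s < min (hausdorff_dim A) (ereal u)"
    using ereal_dense2 by blast
  then have "hausdorff_dim A \<le> ereal s"
    using assms unfolding hausdorff_dim_def by (intro Inf_lower) auto
  with s show False by (meson leD min_less_iff_conj)
qed

section \<open>Mean value estimate for separated frequencies\<close>

text \<open>
  The weight \<open>(4 - x\<^sup>2) / 3\<close> is at least \<open>1\<close> on \<open>[0, 1]\<close> and vanishes at \<open>\<plusminus>2\<close>, so that its cosine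
  transform decays like \<open>\<theta>\<close> to the power \<open>-2\<close>, which is summable over separated frequencies; the
  sharp cutoff to \<open>[0, 1]\<close> would only give the power \<open>-1\<close>.
\<close>

lemma integral_parabola_cos:
  fixes \<theta> :: real
  assumes "\<theta> \<noteq> 0"
  shows "((\<lambda>x. (4 - x\<^sup>2) / 3 * cos (x * \<theta>)) has_integral
           (4 * sin (2 * \<theta>) / \<theta> ^ 3 - 8 * cos (2 * \<theta>) / \<theta>\<^sup>2) / 3) {-2..2}"
proof -
  define F where "F = (\<lambda>x. ((4 - x\<^sup>2) * sin (x * \<theta>) / \<theta> - 2 * x * cos (x * \<theta>) / \<theta>\<^sup>2
     + 2 * sin (x * \<theta>) / \<theta> ^ 3) / 3)"
  have "(F has_real_derivative (4 - x\<^sup>2) / 3 * cos (x * \<theta>)) (at x within {-2..2})" for x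
    unfolding F_def using assms
    by (auto intro!: derivative_eq_intros simp: field_simps power2_eq_square power3_eq_cube)
  then have "((\<lambda>x. (4 - x\<^sup>2) / 3 * cos (x * \<theta>)) has_integral (F 2 - F (- 2))) {-2..2}"
    by (intro fundamental_theorem_of_calculus)
       (auto simp: has_real_derivative_iff_has_vector_derivative)
  moreover have "F 2 - F (- 2) = (4 * sin (2 * \<theta>) / \<theta> ^ 3 - 8 * cos (2 * \<theta>) / \<theta>\<^sup>2) / 3"
    by (simp add: F_def field_simps)
  ultimately show ?thesis by simp
qed

text \<open>The bound \<open>\<bar>sin (2 * \<theta>)\<bar> \<le> 2 * \<bar>\<theta>\<bar>\<close>
  turns the cubic term into a quadratic one. The constants add up to \<open>16 / 3\<close>, rounded
  up to \<open>6\<close>.\<close>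

lemma integral_parabola_cos_le:
  fixes \<theta> :: real
  assumes "\<theta> \<noteq> 0"
  shows "integral {-2..2} (\<lambda>x. (4 - x\<^sup>2) / 3 * cos (x * \<theta>)) \<le> 6 / \<theta>\<^sup>2"
proof -
  have "sin (2 * \<theta>) / \<theta> ^ 3 \<le> \<bar>sin (2 * \<theta>)\<bar> / \<bar>\<theta>\<bar> ^ 3"
    by (metis abs_divide abs_ge_self power_abs)
  also have "\<dots> \<le> 2 * \<bar>\<theta>\<bar> / \<bar>\<theta>\<bar> ^ 3"
    using abs_sin_x_le_abs_x[of "2 * \<theta>"] by (intro divide_right_mono) auto
  also have "\<dots> = 2 / \<theta>\<^sup>2"
    using assms by (simp add: power3_eq_cube power2_eq_square field_simps)
  finally have 1: "sin (2 * \<theta>) / \<theta> ^ 3 \<le> 2 / \<theta>\<^sup>2" .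
  have 2: "- cos (2 * \<theta>) / \<theta>\<^sup>2 \<le> 1 / \<theta>\<^sup>2"
    by (intro divide_right_mono) (use cos_ge_minus_one[of "2 * \<theta>"] in auto)
  have "integral {-2..2} (\<lambda>x. (4 - x\<^sup>2) / 3 * cos (x * \<theta>)) =
      (4 * (sin (2 * \<theta>) / \<theta> ^ 3) + 8 * (- cos (2 * \<theta>) / \<theta>\<^sup>2)) / 3"
    unfolding integral_unique[OF integral_parabola_cos[OF assms]] by simp
  also have "\<dots> \<le> (4 * (2 / \<theta>\<^sup>2) + 8 * (1 / \<theta>\<^sup>2)) / 3"
    using 1 2 by (intro divide_right_mono add_mono mult_left_mono) auto
  also have "\<dots> = (16 / 3) / \<theta>\<^sup>2"
    by simp
  also have "\<dots> \<le> 6 / \<theta>\<^sup>2"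
    by (intro divide_right_mono) auto
  finally show ?thesis .
qed

text \<open>Telescoping: \<open>1 / (n + 1)^2\<close> is at most
  \<open>1 / n - 1 / (n + 1)\<close>.\<close>

lemma sum_inverse_squares_nat_le:
  fixes S :: "nat set"
  assumes "finite S" "0 \<notin> S"
  shows "(\<Sum>k\<in>S. 1 / (real k)\<^sup>2) \<le> 2"
proof -
  have *: "(\<Sum>k=1..n. 1 / (real k)\<^sup>2) \<le> 2 - 1 / real n" if "n \<ge> 1" for n
    using that
  proof (induction n rule: dec_induct)
    case (step n)
    have "1 / (real (Suc n))\<^sup>2 \<le> 1 / real n - 1 / real (Suc n)"
    proof -
      have "1 / (real (Suc n))\<^sup>2 \<le> 1 / (real n * real (Suc n))"
        using step by (intro divide_left_mono) (auto simp: power2_eq_square)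
      also have "\<dots> = 1 / real n - 1 / real (Suc n)"
        using step by (simp add: field_simps)
      finally show ?thesis .
    qed
    then show ?case using step by simp
  qed simp
  show ?thesis
  proof (cases "S = {}")
    case False
    have "(\<Sum>k\<in>S. 1 / (real k)\<^sup>2) \<le> (\<Sum>k=1..Max S. 1 / (real k)\<^sup>2)"
      using assms by (intro sum_mono2) (auto simp: Suc_le_eq intro!: gr0I)
    also have "Max S \<ge> 1"
      using assms False by (metis Max_in One_nat_def Suc_leI neq0_conv)
    then have "(\<Sum>k=1..Max S. 1 / (real k)\<^sup>2) \<le> 2 - 1 / real (Max S)"
      by (rule *)
    also have "\<dots> \<le> 2" by simp
    finally show ?thesis .
  qed simp
qed

lemma sum_inverse_squares_int_le:
  fixes S :: "int set"
  assumes "finite S" "0 \<notin> S"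
  shows "(\<Sum>k\<in>S. 1 / (real_of_int k)\<^sup>2) \<le> 4"
proof -
  define P Q where "P = {k\<in>S. k > 0}" and "Q = {k\<in>S. k < 0}"
  have "(\<Sum>k\<in>P. 1 / (real_of_int k)\<^sup>2) = (\<Sum>k\<in>nat ` P. 1 / (real k)\<^sup>2)"
    by (subst sum.reindex) (auto simp: P_def inj_on_def intro!: sum.cong)
  also have "\<dots> \<le> 2"
    using assms by (intro sum_inverse_squares_nat_le) (auto simp: P_def)
  finally have P: "(\<Sum>k\<in>P. 1 / (real_of_int k)\<^sup>2) \<le> 2" .
  have "(\<Sum>k\<in>Q. 1 / (real_of_int k)\<^sup>2) = (\<Sum>k\<in>(\<lambda>k. nat (- k)) ` Q. 1 / (real k)\<^sup>2)"
    by (subst sum.reindex) (auto simp: Q_def inj_on_def intro!: sum.cong)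
  also have "\<dots> \<le> 2"
    using assms by (intro sum_inverse_squares_nat_le) (auto simp: Q_def)
  finally have Q: "(\<Sum>k\<in>Q. 1 / (real_of_int k)\<^sup>2) \<le> 2" .
  have "S = P \<union> Q" using assms by (auto simp: P_def Q_def) (metis linorder_neqE)
  moreover have "P \<inter> Q = {}" "finite P" "finite Q" using assms by (auto simp: P_def Q_def)
  ultimately show ?thesis using P Q by (simp add: sum.union_disjoint)
qed

text \<open>Writing \<open>r = q ^ 3\<close>, two of the three factors \<open>q ^ i\<close> absorb
  the square because \<open>i * q ^ i\<close> is bounded, and the third leaves a geometric
  series.\<close>

lemma summable_square_mult_power:
  fixes r :: real
  assumes "0 < r" "r < 1"
  shows "summable (\<lambda>i. (real i + 1)\<^sup>2 * r ^ i)"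
proof -
  define q where "q = root 3 r"
  have q: "0 < q" "q < 1" "r = q ^ 3"
    using assms by (auto simp: q_def)
  have "(\<lambda>n. real n * q ^ n) \<longlonglongrightarrow> 0"
    using powser_times_n_limit_0[of q] q by simp
  then have "Bseq (\<lambda>n. real n * q ^ n)"
    using convergent_imp_Bseq convergentI by blast
  then obtain B where B: "\<And>n. norm (real n * q ^ n) \<le> B"
    unfolding Bseq_def by blast
  have "summable (\<lambda>i. (B + 1)\<^sup>2 * q ^ i)"
    using q by (intro summable_mult summable_geometric) auto
  then show ?thesis
  proof (rule summable_comparison_test')
    fix n :: nat
    have "(real n + 1) * q ^ n \<le> B + 1"
      using B[of n] q power_le_one[of q n] by (simp add: algebra_simps)
    then have "((real n + 1) * q ^ n)\<^sup>2 * q ^ n \<le> (B + 1)\<^sup>2 * q ^ n"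
      using q by (intro mult_right_mono power_mono) auto
    moreover have "((real n + 1) * q ^ n)\<^sup>2 * q ^ n = (real n + 1)\<^sup>2 * r ^ n"
      unfolding q(3) by (simp add: power_mult_distrib power2_eq_square power3_eq_cube)
    ultimately show "norm ((real n + 1)\<^sup>2 * r ^ n) \<le> (B + 1)\<^sup>2 * q ^ n"
      using assms by simp
  qed
qed

lemma e_char_of_real: "e_char (of_real t) = cis (2 * pi * t)"
  by (simp add: e_char_def cis_conv_exp mult_ac)

lemma cmod_sum_cis_squared:
  assumes "finite B"
  shows "(cmod (\<Sum>n\<in>B. cis (a n)))\<^sup>2 = (\<Sum>n\<in>B. \<Sum>m\<in>B. cos (a n - a m))"
  by (subst cmod_power2) (simp add: power2_eq_square sum_product cos_diff sum.distrib)

text \<open>Rounding \<open>f m / c\<close> down gives distinct integers. Rounding changes a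
  difference by less than \<open>1\<close>, and the true difference is at least \<open>1\<close> in
  units of \<open>c\<close>, so integer differences are at most twice the true ones. This costs a
  factor \<open>4\<close> on top of the integer bound \<open>4\<close>.\<close>

lemma sum_inverse_squares_separated_le:
  fixes f :: "nat \<Rightarrow> real"
  assumes "0 < c" "finite B" "n \<in> B"
    and sep: "\<And>n m. n \<in> B \<Longrightarrow> m \<in> B \<Longrightarrow> n \<noteq> m \<Longrightarrow> c \<le> \<bar>f n - f m\<bar>"
  shows "(\<Sum>m\<in>B - {n}. 1 / (f n - f m)\<^sup>2) \<le> 16 / c\<^sup>2"
proof -
  define g where "g m = \<lfloor>f m / c\<rfloor>" for m
  have close: "\<bar>(f m - f k) / c - (real_of_int (g m) - real_of_int (g k))\<bar> < 1" for m k
    unfolding g_def diff_divide_distrib by linarith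
  have far: "1 \<le> \<bar>(f m - f k) / c\<bar>" if "m \<in> B" "k \<in> B" "m \<noteq> k" for m k
    using sep[OF that] \<open>0 < c\<close> by (simp add: abs_divide)
  have inj: "inj_on g B"
  proof (rule inj_onI, rule ccontr)
    fix m k assume "m \<in> B" "k \<in> B" "g m = g k" "m \<noteq> k"
    then show False using close[of m k] far[of m k] by simp
  qed
  have "1 / (f n - f m)\<^sup>2 \<le> 4 / c\<^sup>2 * (1 / (real_of_int (g n - g m))\<^sup>2)" if m: "m \<in> B - {n}" for m
  proof -
    have ne: "g n \<noteq> g m" using inj m assms(3) by (auto dest: inj_onD)
    have "\<bar>real_of_int (g n - g m)\<bar> \<le> 2 * \<bar>(f n - f m) / c\<bar>"
      using close[of n m] far[of n m] m assms(3) by fastforce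
    then have "\<bar>real_of_int (g n - g m)\<bar>\<^sup>2 \<le> (2 * \<bar>(f n - f m) / c\<bar>)\<^sup>2"
      by (intro power_mono) auto
    then have "(real_of_int (g n - g m))\<^sup>2 \<le> 4 * (f n - f m)\<^sup>2 / c\<^sup>2"
      by (simp add: power_mult_distrib power_divide abs_divide)
    then have "c\<^sup>2 / 4 * (real_of_int (g n - g m))\<^sup>2 \<le> (f n - f m)\<^sup>2"
      using \<open>0 < c\<close> by (simp add: field_simps)
    moreover have "0 < c\<^sup>2 / 4 * (real_of_int (g n - g m))\<^sup>2"
      using \<open>0 < c\<close> ne by simp
    ultimately have "1 / (f n - f m)\<^sup>2 \<le> 1 / (c\<^sup>2 / 4 * (real_of_int (g n - g m))\<^sup>2)"
      by (intro divide_left_mono mult_pos_pos) auto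
    then show ?thesis by simp
  qed
  then have "(\<Sum>m\<in>B - {n}. 1 / (f n - f m)\<^sup>2) \<le>
      (\<Sum>m\<in>B - {n}. 4 / c\<^sup>2 * (1 / (real_of_int (g n - g m))\<^sup>2))"
    by (rule sum_mono)
  also have "\<dots> = 4 / c\<^sup>2 * (\<Sum>m\<in>B - {n}. 1 / (real_of_int (g n - g m))\<^sup>2)"
    by (simp only: sum_distrib_left)
  also have "\<dots> = 4 / c\<^sup>2 *
      (\<Sum>k\<in>(\<lambda>m. g n - g m) ` (B - {n}). 1 / (real_of_int k)\<^sup>2)"
    using inj by (subst sum.reindex) (auto simp: inj_on_def)
  also have "\<dots> \<le> 4 / c\<^sup>2 * 4"
    using inj assms by (intro mult_left_mono sum_inverse_squares_int_le) (auto simp: inj_on_def)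
  finally show ?thesis
    by simp
qed

text \<open>Inserting the weight, which is nonnegative on \<open>[-2, 2]\<close>, and expanding the
  square leaves cosine integrals. Each row of the double sum has a bounded diagonal term and
  off-diagonal terms controlled by inverse squares of the frequency gaps.\<close>

lemma mean_square_le:
  fixes f :: "nat \<Rightarrow> real"
  assumes "0 < c" "finite B"
    and sep: "\<And>n m. n \<in> B \<Longrightarrow> m \<in> B \<Longrightarrow> n \<noteq> m \<Longrightarrow> c \<le> \<bar>f n - f m\<bar>"
  shows "integral {0..1} (\<lambda>x. (cmod (\<Sum>n\<in>B. e_char (of_real (x * f n))))\<^sup>2)
           \<le> (6 + 16 / c\<^sup>2) * real (card B)"
proof -
  define S where "S x = (cmod (\<Sum>n\<in>B. e_char (of_real (x * f n))))\<^sup>2" for x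
  define w where "w x = (4 - x\<^sup>2) / 3" for x :: real
  have S_eq: "S x = (\<Sum>n\<in>B. \<Sum>m\<in>B. cos (x * (2 * pi * (f n - f m))))" for x
    unfolding S_def e_char_of_real cmod_sum_cis_squared[OF \<open>finite B\<close>]
    by (simp add: algebra_simps)
  have cont_S: "continuous_on A S" for A
    unfolding S_eq[abs_def] by (intro continuous_intros)
  have cont_w: "continuous_on A w" for A
    unfolding w_def by (intro continuous_intros) auto
  have S_nonneg: "0 \<le> S x" for x by (simp add: S_def)
  have int_wS: "(\<lambda>x. w x * S x) integrable_on {a..b}" for a b
    by (intro integrable_continuous_real continuous_intros cont_S cont_w)
  have int_wcos: "(\<lambda>x. w x * cos (x * t)) integrable_on {a..b}" for a b t
    by (intro integrable_continuous_real continuous_intros cont_w)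
  have "integral {0..1} S \<le> integral {0..1} (\<lambda>x. w x * S x)"
  proof (rule integral_le)
    fix x :: real assume "x \<in> {0..1}"
    then have "1 \<le> w x" using power_le_one[of x 2] by (simp add: w_def)
    then show "S x \<le> w x * S x" using S_nonneg[of x] mult_right_mono[of 1 "w x" "S x"] by simp
  qed (auto intro!: int_wS integrable_continuous_real cont_S)
  also have "\<dots> \<le> integral {-2..2} (\<lambda>x. w x * S x)"
  proof (intro integral_subset_le ballI int_wS)
    fix x :: real assume "x \<in> {-2..2}"
    then have "x\<^sup>2 \<le> 2\<^sup>2" by (intro power2_le_iff_abs_le[THEN iffD2]) auto
    then show "0 \<le> w x * S x" using S_nonneg by (simp add: w_def)
  qed auto
  also have "\<dots> = integral {-2..2} (\<lambda>x. \<Sum>n\<in>B. \<Sum>m\<in>B. w x * cos (x * (2 * pi * (f n - f m))))"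
    by (simp add: S_eq sum_distrib_left)
  also have "\<dots> = (\<Sum>n\<in>B. \<Sum>m\<in>B. integral {-2..2} (\<lambda>x. w x * cos (x * (2 * pi * (f n - f m)))))"
    using \<open>finite B\<close> by (simp add: integral_sum integrable_sum int_wcos)
  also have "\<dots> \<le> (\<Sum>n\<in>B. 6 + 16 / c\<^sup>2)"
  proof (rule sum_mono)
    fix n assume n: "n \<in> B"
    have "integral {-2..2} (\<lambda>x. w x * cos (x * (2 * pi * (f n - f m)))) \<le> 1 / (f n - f m)\<^sup>2"
      if m: "m \<in> B - {n}" for m
    proof -
      have ne: "f n - f m \<noteq> 0" using sep[of n m] n m \<open>0 < c\<close> by auto
      have "integral {-2..2} (\<lambda>x. w x * cos (x * (2 * pi * (f n - f m)))) \<le>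
          6 / (2 * pi * (f n - f m))\<^sup>2"
        unfolding w_def by (intro integral_parabola_cos_le) (use ne in auto)
      also have "\<dots> = (6 / (2 * pi)\<^sup>2) * (1 / (f n - f m)\<^sup>2)"
        by (simp add: power_mult_distrib)
      also have "(2 * pi)\<^sup>2 \<ge> 6\<^sup>2"
        using pi_gt3 by (intro power_mono) auto
      then have "6 / (2 * pi)\<^sup>2 \<le> 1" by simp
      then have "(6 / (2 * pi)\<^sup>2) * (1 / (f n - f m)\<^sup>2) \<le> 1 * (1 / (f n - f m)\<^sup>2)"
        by (intro mult_right_mono) auto
      finally show ?thesis by simp
    qed
    then have "(\<Sum>m\<in>B - {n}. integral {-2..2} (\<lambda>x. w x * cos (x * (2 * pi * (f n - f m)))))
        \<le> (\<Sum>m\<in>B - {n}. 1 / (f n - f m)\<^sup>2)"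
      by (rule sum_mono)
    also have "\<dots> \<le> 16 / c\<^sup>2"
      using assms n by (intro sum_inverse_squares_separated_le)
    finally have off: "(\<Sum>m\<in>B - {n}. integral {-2..2} (\<lambda>x. w x * cos (x * (2 * pi * (f n - f m)))))
        \<le> 16 / c\<^sup>2" .
    \<comment> \<open>The diagonal term \<open>m = n\<close>, where the cosine is
      \<open>1\<close>.\<close>
    have "integral {-2..2} w \<le> integral {-2..2::real} (\<lambda>x. 4 / 3)"
      by (intro integral_le integrable_continuous_real cont_w continuous_intros)
         (auto simp: w_def field_simps)
    then have "integral {-2..2} w \<le> 16 / 3"
      by simp
    then show "(\<Sum>m\<in>B. integral {-2..2} (\<lambda>x. w x * cos (x * (2 * pi * (f n - f m))))) \<le> 6 + 16 / c\<^sup>2"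
      using off n \<open>finite B\<close> by (simp add: sum.remove[of B n])
  qed
  finally show ?thesis unfolding S_def[abs_def] by (simp only: sum_constant mult.commute)
qed

section \<open>Maximal inequality over dyadic blocks\<close>

text \<open>
  The Rademacher--Menshov device: every interval \<open>(p, p + N]\<close> with \<open>N < 2\<^sup>i\<close> splits into at most
  \<open>i\<close> of the dyadic blocks whose sums are collected here, so Cauchy--Schwarz bounds all its partial
  sums at once, at the price of a factor \<open>i\<close>.
\<close>

fun dyadic_energy :: "(nat \<Rightarrow> complex) \<Rightarrow> nat \<Rightarrow> nat \<Rightarrow> real" where
  "dyadic_energy v p 0 = 0"
| "dyadic_energy v p (Suc i) =
     (cmod (\<Sum>n=p+1..p+2^i. v n))\<^sup>2 + dyadic_energy v p i + dyadic_energy v (p + 2^i) i"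

lemma dyadic_energy_nonneg: "0 \<le> dyadic_energy v p i"
  by (induction i arbitrary: p) auto

text \<open>Weighted Cauchy-Schwarz, with the defect written as an explicit square. Taking
  \<open>t = i\<close> raises the factor \<open>i\<close> of the dyadic bound to only
  \<open>i + 1\<close>.\<close>

lemma norm_add_squared_le:
  fixes x y :: "'a::real_normed_vector" and t :: real
  assumes "0 < t"
  shows "(norm (x + y))\<^sup>2 \<le> (t + 1) * ((norm x)\<^sup>2 + (norm y)\<^sup>2 / t)"
proof -
  have "(norm (x + y))\<^sup>2 \<le> (norm x + norm y)\<^sup>2"
    by (intro power_mono norm_triangle_ineq) auto
  also have "(norm x + norm y)\<^sup>2 = (t + 1) * ((norm x)\<^sup>2 + (norm y)\<^sup>2 / t) - (t * norm x - norm y)\<^sup>2 / t"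
    using assms by (simp add: field_simps power2_eq_square)
  also have "\<dots> \<le> (t + 1) * ((norm x)\<^sup>2 + (norm y)\<^sup>2 / t)"
    using assms by simp
  finally show ?thesis .
qed

text \<open>If \<open>N\<close> is at least \<open>2 ^ i\<close>, the leading block of length
  \<open>2 ^ i\<close> is split off, and the rest, shorter than \<open>2 ^ i\<close>, falls under
  the induction hypothesis at the shifted start.\<close>

lemma partial_sum_le_dyadic_energy:
  assumes "N < 2 ^ i"
  shows "(cmod (\<Sum>n=p+1..p+N. v n))\<^sup>2 \<le> real i * dyadic_energy v p i"
  using assms
proof (induction i arbitrary: p N)
  case (Suc i)
  note nonneg = dyadic_energy_nonneg[of v]
  show ?case
  proof (cases "N < 2 ^ i")
    case True
    have "(cmod (\<Sum>n=p+1..p+N. v n))\<^sup>2 \<le> real i * dyadic_energy v p i"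
      by (rule Suc.IH[OF True])
    also have "\<dots> \<le> real (Suc i) * dyadic_energy v p (Suc i)"
      using nonneg by (intro mult_mono) auto
    finally show ?thesis .
  next
    case False
    then obtain M where N: "N = 2 ^ i + M"
      by (metis le_Suc_ex not_less)
    with Suc.prems have M: "M < 2 ^ i" by simp
    define A where "A = (\<Sum>n=p+1..p+2^i. v n)"
    define B where "B = (\<Sum>n=(p+2^i)+1..(p+2^i)+M. v n)"
    have "{p+1..p+N} = {p+1..p+2^i} \<union> {(p+2^i)+1..(p+2^i)+M}"
      using N by auto
    then have AB: "(\<Sum>n=p+1..p+N. v n) = A + B"
      unfolding A_def B_def by (simp add: sum.union_disjoint)
    have IH: "(cmod B)\<^sup>2 \<le> real i * dyadic_energy v (p + 2^i) i"
      unfolding B_def by (rule Suc.IH[OF M])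
    have "(cmod (A + B))\<^sup>2 \<le> real (Suc i) * ((cmod A)\<^sup>2 + dyadic_energy v (p + 2^i) i)"
    \<comment> \<open>The weight \<open>t = i\<close> must be positive. For \<open>i = 0\<close> the
      remainder is empty.\<close>
    proof (cases "i = 0")
      case True
      then have "B = 0" using M by (simp add: B_def)
      then show ?thesis using True by simp
    next
      case False
      have "(cmod (A + B))\<^sup>2 \<le> (real i + 1) * ((cmod A)\<^sup>2 + (cmod B)\<^sup>2 / real i)"
        using False by (intro norm_add_squared_le) auto
      also have "\<dots> \<le> (real i + 1) * ((cmod A)\<^sup>2 + dyadic_energy v (p + 2^i) i)"
        using IH False by (intro mult_left_mono add_mono) (auto simp: field_simps)
      finally show ?thesis by (simp add: add.commute)
    qed
    also have "\<dots> \<le> real (Suc i) * dyadic_energy v p (Suc i)"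
      using nonneg by (intro mult_left_mono) (auto simp: A_def)
    finally show ?thesis unfolding AB .
  qed
qed simp

lemma continuous_on_dyadic_energy:
  assumes "\<And>n. continuous_on A (\<lambda>x. v x n)"
  shows "continuous_on A (\<lambda>x. dyadic_energy (v x) p i)"
  by (induction i arbitrary: p) (simp_all add: continuous_intros assms)

lemma continuous_on_e_char_mult: "continuous_on A (\<lambda>x. e_char (of_real (x * f n)))"
  unfolding e_char_def by (intro continuous_intros)

text \<open>There are \<open>i\<close> generations of blocks, each of total length
  \<open>2 ^ (i - 1)\<close>, and the mean value bound is linear in the length and uniform in the
  position \<open>p\<close>.\<close>

lemma integral_dyadic_energy_le:
  fixes f :: "nat \<Rightarrow> real"
  assumes "0 < c"
    and sep: "\<And>n m. 1 \<le> n \<Longrightarrow> 1 \<le> m \<Longrightarrow> n \<noteq> m \<Longrightarrow> c \<le> \<bar>f n - f m\<bar>"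
  shows "integral {0..1} (\<lambda>x. dyadic_energy (\<lambda>n. e_char (of_real (x * f n))) p i)
           \<le> (6 + 16 / c\<^sup>2) * (real i * 2 ^ i)"
proof (induction i arbitrary: p)
  case (Suc i)
  define C where "C = 6 + 16 / c\<^sup>2"
  have "0 \<le> C" by (simp add: C_def)
  define v where "v x n = e_char (of_real (x * f n))" for x n
  have cont_v: "continuous_on A (\<lambda>x. v x n)" for A n
    unfolding v_def by (rule continuous_on_e_char_mult)
  have int: "(\<lambda>x. (cmod (\<Sum>n=p+1..p+2^i. v x n))\<^sup>2) integrable_on {0..1}"
    "(\<lambda>x. dyadic_energy (v x) q i) integrable_on {0..1}" for q
    by (intro integrable_continuous_real continuous_intros continuous_on_dyadic_energy cont_v)+
  have block: "integral {0..1} (\<lambda>x. (cmod (\<Sum>n=p+1..p+2^i. v x n))\<^sup>2) \<le> C * real (card {p+1..p+2^i})"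
    unfolding C_def v_def using assms by (intro mean_square_le) auto
  have IH: "integral {0..1} (\<lambda>x. dyadic_energy (v x) q i) \<le> C * (real i * 2 ^ i)" for q
    using Suc.IH[of q] unfolding v_def C_def .
  have "integral {0..1} (\<lambda>x. dyadic_energy (v x) p (Suc i)) =
      integral {0..1} (\<lambda>x. (cmod (\<Sum>n=p+1..p+2^i. v x n))\<^sup>2) +
      integral {0..1} (\<lambda>x. dyadic_energy (v x) p i) +
      integral {0..1} (\<lambda>x. dyadic_energy (v x) (p + 2^i) i)"
    unfolding dyadic_energy.simps by (simp only: integral_add int integrable_add)
  also have "\<dots> \<le> C * 2 ^ i + C * (real i * 2 ^ i) + C * (real i * 2 ^ i)"
    using block by (intro add_mono IH) simp
  also have "\<dots> \<le> C * (real (Suc i) * 2 ^ Suc i)"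
    using \<open>0 \<le> C\<close> by (simp add: algebra_simps)
  finally show ?case unfolding v_def C_def .
qed simp

section \<open>Lipschitz bound and counting of cells with large sums\<close>

lemma cmod_cis_diff_le: "cmod (cis a - cis b) \<le> \<bar>a - b\<bar>"
proof -
  have "cis a - cis b = cis b * (cis (a - b) - 1)"
    by (simp add: algebra_simps cis_mult)
  then have "cmod (cis a - cis b) = 2 * \<bar>sin ((a - b) / 2)\<bar>"
    using dist_exp_i_1[of "a - b"] by (simp add: norm_mult cis_conv_exp)
  also have "\<dots> \<le> \<bar>a - b\<bar>"
    using abs_sin_x_le_abs_x[of "(a - b) / 2"] by simp
  finally show ?thesis .
qed

text \<open>This spreads a large value at one point to the whole cell around it.\<close>

lemma cmod_exp_sum_diff_le:
  "cmod (exp_sum f x N - exp_sum f y N) \<le> 2 * pi * \<bar>x - y\<bar> * (\<Sum>n=1..N. \<bar>f n\<bar>)"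
proof -
  have "cmod (exp_sum f x N - exp_sum f y N) \<le>
      (\<Sum>n=1..N. cmod (cis (2 * pi * (x * f n)) - cis (2 * pi * (y * f n))))"
    unfolding exp_sum_def e_char_of_real sum_subtractf[symmetric] by (rule norm_sum)
  also have "\<dots> \<le> (\<Sum>n=1..N. 2 * pi * \<bar>x - y\<bar> * \<bar>f n\<bar>)"
  proof (rule sum_mono)
    fix n
    have "\<bar>2 * pi * (x * f n) - 2 * pi * (y * f n)\<bar> = \<bar>2 * pi * ((x - y) * f n)\<bar>"
      by (simp add: algebra_simps)
    then show "cmod (cis (2 * pi * (x * f n)) - cis (2 * pi * (y * f n))) \<le> 2 * pi * \<bar>x - y\<bar> * \<bar>f n\<bar>"
      using cmod_cis_diff_le[of "2 * pi * (x * f n)" "2 * pi * (y * f n)"] by (simp add: abs_mult)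
  qed
  finally show ?thesis by (simp add: sum_distrib_left)
qed

lemma integral_cells:
  fixes h :: "real \<Rightarrow> real"
  assumes cont: "continuous_on {0..1} h" and "0 < K" and "j \<le> K"
  shows "integral {0..real j / real K} h =
           (\<Sum>k<j. integral {real k / real K..real (Suc k) / real K} h)"
  using \<open>j \<le> K\<close>
proof (induction j)
  case (Suc j)
  have "real (Suc j) / real K \<le> 1"
    using Suc.prems by simp
  then have "h integrable_on {0..real (Suc j) / real K}"
    by (intro integrable_continuous_real continuous_on_subset[OF cont]) auto
  then have "integral {0..real j / real K} h + integral {real j / real K..real (Suc j) / real K} h =
      integral {0..real (Suc j) / real K} h"
    by (intro Henstock_Kurzweil_Integration.integral_combine) (auto simp: divide_right_mono)
  then show ?case using Suc by simp
qed simp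

text \<open>Chebyshev's inequality on cells: each cell in \<open>J\<close> has length
  \<open>1 / K\<close> and so contributes at least \<open>L / K\<close> to the integral.\<close>

lemma card_cells_le:
  fixes h :: "real \<Rightarrow> real"
  assumes cont: "continuous_on {0..1} h" and nonneg: "\<And>x. x \<in> {0..1} \<Longrightarrow> 0 \<le> h x"
    and "0 < K" and J: "J \<subseteq> {..<K}"
    and large: "\<And>k x. k \<in> J \<Longrightarrow> x \<in> {real k / real K..real (Suc k) / real K} \<Longrightarrow> L \<le> h x"
  shows "real (card J) * L \<le> real K * integral {0..1} h"
proof -
  have sub: "{real k / real K..real (Suc k) / real K} \<subseteq> {0..1}" if "k < K" for k
  proof -
    have "real (Suc k) / real K \<le> 1" "0 \<le> real k / real K" using that by auto
    then show ?thesis by auto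
  qed
  have int: "h integrable_on {real k / real K..real (Suc k) / real K}" if "k < K" for k
    using sub[OF that] by (intro integrable_continuous_real continuous_on_subset[OF cont])
  have "L / real K \<le> integral {real k / real K..real (Suc k) / real K} h" if "k \<in> J" for k
  proof -
    have "integral {real k / real K..real (Suc k) / real K} (\<lambda>_. L) \<le>
        integral {real k / real K..real (Suc k) / real K} h"
      using that J by (intro integral_le large int) auto
    moreover have "real (Suc k) / real K - real k / real K = 1 / real K"
      by (simp add: diff_divide_distrib[symmetric])
    ultimately show ?thesis by (simp add: divide_right_mono)
  qed
  then have "real (card J) * (L / real K) \<le>
      (\<Sum>k\<in>J. integral {real k / real K..real (Suc k) / real K} h)"
    by (rule sum_bounded_below)
  also have "\<dots> \<le> (\<Sum>k<K. integral {real k / real K..real (Suc k) / real K} h)"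
    using J sub nonneg by (intro sum_mono2 integral_nonneg int) (auto simp: subset_iff)
  also have "\<dots> = integral {0..1} h"
    using integral_cells[OF cont \<open>0 < K\<close> order_refl] \<open>0 < K\<close> by simp
  finally show ?thesis using \<open>0 < K\<close> by (simp add: field_simps)
qed

definition cell :: "nat \<Rightarrow> nat \<Rightarrow> real set" where
  "cell K k = {real k / real K..real (Suc k) / real K}"

lemma cell_cover:
  assumes "x \<in> {0..1}" "0 < K"
  obtains k where "k < K" "x \<in> cell K k"
proof (cases "x = 1")
  \<comment> \<open>At \<open>x = 1\<close> the floor would give the index \<open>K\<close>, which
    is out of range. The last closed cell contains this point.\<close>
  case True
  with \<open>0 < K\<close> have "K - 1 < K" "x \<in> cell K (K - 1)"
    by (auto simp: cell_def field_simps of_nat_diff)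
  then show ?thesis by (rule that)
next
  case False
  define k where "k = nat \<lfloor>x * real K\<rfloor>"
  have k: "real k \<le> x * real K" "x * real K < real (Suc k)"
    using assms by (auto simp: k_def) linarith+
  moreover have "x * real K < real K" using False assms by simp
  ultimately have "k < K" by linarith
  moreover have "x \<in> cell K k"
    using k \<open>0 < K\<close> by (auto simp: cell_def field_simps)
  ultimately show ?thesis by (rule that)
qed

definition dyadic_large_set :: "(nat \<Rightarrow> real) \<Rightarrow> real \<Rightarrow> nat \<Rightarrow> real set" where
  "dyadic_large_set f \<alpha> i =
     {x \<in> {0..1}. \<exists>N. 2 ^ i \<le> N \<and> N < 2 ^ Suc i \<and> real N powr \<alpha> \<le> cmod (exp_sum f x N)}"

text \<open>Only finitely many \<open>N\<close> lie below \<open>2 ^ m\<close>, so arbitrarily late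
  dyadic ranges contain an \<open>N\<close> with a large sum.\<close>

lemma large_sums_set_limsup:
  assumes "x \<in> large_sums_set f \<alpha>"
  shows "\<exists>\<^sub>\<infinity>i. x \<in> dyadic_large_set f \<alpha> i"
  unfolding INFM_nat_le
proof
  fix m
  from assms obtain N where N: "2 ^ m \<le> N" "real N powr \<alpha> \<le> cmod (exp_sum f x N)"
    unfolding large_sums_set_def INFM_nat_le by blast
  then have "N \<ge> 1" using order_trans[OF one_le_power[of "2::nat" m]] by simp
  then obtain i where i: "2 ^ i \<le> N" "N < 2 ^ Suc i"
    using ex_power_ivl1[of 2 N] by auto
  have "m \<le> i"
  proof (rule ccontr)
    assume "\<not> m \<le> i"
    then have "(2::nat) ^ Suc i \<le> 2 ^ m" by (intro power_increasing) auto
    with i N show False by linarith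
  qed
  then show "\<exists>i\<ge>m. x \<in> dyadic_large_set f \<alpha> i"
    using assms i N by (auto simp: dyadic_large_set_def large_sums_set_def)
qed

lemma zero_in_dyadic_large_set:
  assumes "\<alpha> \<le> 1"
  shows "0 \<in> dyadic_large_set f \<alpha> i"
proof -
  have "exp_sum f 0 (2 ^ i) = of_nat (2 ^ i)"
    by (simp add: exp_sum_def e_char_def)
  then have "cmod (exp_sum f 0 (2 ^ i)) = real (2 ^ i)"
    by (metis norm_of_nat)
  moreover have "real (2 ^ i) powr \<alpha> \<le> real (2 ^ i) powr 1"
    using assms by (intro powr_mono) auto
  ultimately show ?thesis
    unfolding dyadic_large_set_def by (auto intro!: exI[of _ "2 ^ i"])
qed

definition large_cells :: "(nat \<Rightarrow> real) \<Rightarrow> real \<Rightarrow> nat \<Rightarrow> nat \<Rightarrow> nat set" where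
  "large_cells f \<alpha> i K = {k \<in> {..<K}. cell K k \<inter> dyadic_large_set f \<alpha> i \<noteq> {}}"

lemma finite_large_cells: "finite (large_cells f \<alpha> i K)"
  by (simp add: large_cells_def)

text \<open>The \<open>mesh\<close> hypothesis keeps the variation of the sum across a cell below
  half of the threshold, so the dyadic energy is large on the entire cell and
  \<open>card_cells_le\<close> applies to it.\<close>

lemma card_large_cells_le:
  fixes f :: "nat \<Rightarrow> real"
  assumes "0 < c"
    and sep: "\<And>n m. 1 \<le> n \<Longrightarrow> 1 \<le> m \<Longrightarrow> n \<noteq> m \<Longrightarrow> c \<le> \<bar>f n - f m\<bar>"
    and "0 \<le> \<alpha>" "0 < K"
    and mesh: "\<And>N. 2 ^ i \<le> N \<Longrightarrow> N < 2 ^ Suc i \<Longrightarrow>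
                 4 * pi * (\<Sum>n=1..N. \<bar>f n\<bar>) \<le> real K * real N powr \<alpha>"
  shows "real (card (large_cells f \<alpha> i K)) * (2 powr (real i * \<alpha>))\<^sup>2
           \<le> 8 * (6 + 16 / c\<^sup>2) * (real i + 1)\<^sup>2 * 2 ^ i * real K"
proof -
  define v where "v x n = e_char (of_real (x * f n))" for x n
  \<comment> \<open>Level \<open>Suc i\<close> handles every \<open>N < 2 ^ Suc i\<close>, and start
    \<open>0\<close> matches sums beginning at \<open>n = 1\<close>.\<close>
  define h where "h x = dyadic_energy (v x) 0 (Suc i)" for x
  define P where "P = 2 powr (real i * \<alpha>)"
  have cont: "continuous_on {0..1} h"
    unfolding h_def v_def by (intro continuous_on_dyadic_energy continuous_on_e_char_mult)
  have large: "(P / 2)\<^sup>2 / real (Suc i) \<le> h y" if k: "k \<in> large_cells f \<alpha> i K" and y: "y \<in> cell K k" for k y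
  proof -
    from k obtain x where x: "x \<in> cell K k" "x \<in> dyadic_large_set f \<alpha> i"
      unfolding large_cells_def by blast
    from x(2) obtain N where N: "2 ^ i \<le> N" "N < 2 ^ Suc i" "real N powr \<alpha> \<le> cmod (exp_sum f x N)"
      unfolding dyadic_large_set_def by blast
    have "real (Suc k) / real K - real k / real K = 1 / real K"
      by (simp add: diff_divide_distrib[symmetric])
    with x(1) y have "\<bar>x - y\<bar> \<le> 1 / real K"
      unfolding cell_def atLeastAtMost_iff by linarith
    then have "2 * pi * \<bar>x - y\<bar> * (\<Sum>n=1..N. \<bar>f n\<bar>) \<le> 2 * pi * (1 / real K) * (\<Sum>n=1..N. \<bar>f n\<bar>)"
      by (intro mult_right_mono mult_left_mono sum_nonneg) auto
    also have "\<dots> \<le> real N powr \<alpha> / 2"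
      using mesh[OF N(1,2)] \<open>0 < K\<close> by (simp add: field_simps)
    finally have "cmod (exp_sum f x N - exp_sum f y N) \<le> real N powr \<alpha> / 2"
      using cmod_exp_sum_diff_le[of f x N y] by linarith
    then have "real N powr \<alpha> / 2 \<le> cmod (exp_sum f y N)"
      using N(3) norm_triangle_ineq2[of "exp_sum f x N" "exp_sum f y N"] by linarith
    moreover have "P = real (2 ^ i) powr \<alpha>"
      by (simp add: P_def powr_powr[symmetric] powr_realpow)
    then have "P \<le> real N powr \<alpha>"
      using N(1) \<open>0 \<le> \<alpha>\<close> by (simp only:) (intro powr_mono2; simp flip: of_nat_power)
    ultimately have "(P / 2)\<^sup>2 \<le> (cmod (exp_sum f y N))\<^sup>2"
      by (intro power_mono) (auto simp: P_def)
    also have "\<dots> \<le> real (Suc i) * h y"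
      using partial_sum_le_dyadic_energy[OF N(2), where p = 0 and v = "v y"]
      by (simp add: h_def v_def exp_sum_def del: dyadic_energy.simps)
    finally show ?thesis by (simp add: field_simps)
  qed
  have "real (card (large_cells f \<alpha> i K)) * ((P / 2)\<^sup>2 / real (Suc i)) \<le> real K * integral {0..1} h"
    using large dyadic_energy_nonneg \<open>0 < K\<close>
    by (intro card_cells_le cont) (auto simp: large_cells_def cell_def h_def simp del: dyadic_energy.simps)
  also have "\<dots> \<le> real K * ((6 + 16 / c\<^sup>2) * (real (Suc i) * 2 ^ Suc i))"
    unfolding h_def v_def using assms(1) sep by (intro mult_left_mono integral_dyadic_energy_le) auto
  \<comment> \<open>Multiplying by \<open>4 * real (Suc i)\<close> clears the denominators. With the
    \<open>2\<close> from \<open>2 ^ Suc i\<close> this gives the constant \<open>8\<close>.\<close>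
  finally have "real (card (large_cells f \<alpha> i K)) * ((P / 2)\<^sup>2 / real (Suc i)) * (4 * real (Suc i))
      \<le> real K * ((6 + 16 / c\<^sup>2) * (real (Suc i) * 2 ^ Suc i)) * (4 * real (Suc i))"
    by (intro mult_right_mono) auto
  moreover have "real (card (large_cells f \<alpha> i K)) * ((P / 2)\<^sup>2 / real (Suc i)) * (4 * real (Suc i)) =
      real (card (large_cells f \<alpha> i K)) * P\<^sup>2"
    by (simp add: power_divide)
  moreover have "real K * (B * (real (Suc i) * 2 ^ Suc i)) * (4 * real (Suc i)) =
      8 * B * (real i + 1)\<^sup>2 * 2 ^ i * real K" for B :: real
    by (simp add: power2_eq_square algebra_simps)
  ultimately show ?thesis by (simp only: P_def)
qed

section \<open>Choice of the mesh and the dimension bound\<close>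

theorem theorem3p5:
  fixes f :: "nat \<Rightarrow> real" and \<tau> \<alpha> :: real
  assumes sep: "\<exists>c>0. \<forall>n\<ge>1. \<forall>m\<ge>1. n \<noteq> m \<longrightarrow> c \<le> \<bar>f n - f m\<bar>"
    and tau: "\<tau> > 0"
    and avg: "\<exists>C>0. \<forall>\<^sub>F N in sequentially.
                (1 / real N) * (\<Sum>n=1..N. \<bar>f n\<bar>) \<le> C * real N powr \<tau>"
    and alpha: "1 / 2 < \<alpha>" "\<alpha> < 1"
  shows "hausdorff_dim (large_sums_set f \<alpha>) \<le> ereal (1 - (2 * \<alpha> - 1) / (\<tau> + 1 - \<alpha>))"
proof -
  obtain c where c: "0 < c" "\<And>n m. 1 \<le> n \<Longrightarrow> 1 \<le> m \<Longrightarrow> n \<noteq> m \<Longrightarrow> c \<le> \<bar>f n - f m\<bar>"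
    using sep by blast
  obtain C N0 where C: "0 < C"
    "\<And>N. N \<ge> N0 \<Longrightarrow> (1 / real N) * (\<Sum>n=1..N. \<bar>f n\<bar>) \<le> C * real N powr \<tau>"
    using avg unfolding eventually_sequentially by blast
  define \<beta> where "\<beta> = \<tau> + 1 - \<alpha>"
  define s0 where "s0 = 1 - (2 * \<alpha> - 1) / \<beta>"
  have beta: "0 < \<beta>" using tau alpha by (simp add: \<beta>_def)
  have s0: "s0 < 1" using beta alpha by (simp add: s0_def)
  \<comment> \<open>The factor \<open>4 * pi\<close> comes from the mesh condition and
    \<open>2 powr \<beta>\<close> from \<open>N < 2 ^ Suc i\<close>. Adding \<open>1\<close> ensures
    \<open>A \<ge> 1\<close>, so that the ceiling in \<open>K\<close> at most doubles its
    argument.\<close>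
  define A where "A = 4 * pi * C * 2 powr \<beta> + 1"
  have A: "1 \<le> A" using C by (simp add: A_def)
  define K where "K i = nat \<lceil>A * 2 powr (real i * \<beta>)\<rceil>" for i
  have ge1: "1 \<le> A * 2 powr (real i * \<beta>)" for i
    using A beta mult_mono[of 1 A 1 "2 powr (real i * \<beta>)"] ge_one_powr_ge_zero[of 2 "real i * \<beta>"] by simp
  have K_lower: "A * 2 powr (real i * \<beta>) \<le> real (K i)" for i
    unfolding K_def by linarith
  have K_upper: "real (K i) \<le> 2 * A * 2 powr (real i * \<beta>)" for i
    unfolding K_def using ge1[of i] by linarith
  have K_pos: "0 < K i" for i
    using K_lower[of i] ge1[of i] by linarith
  define J where "J i = large_cells f \<alpha> i (K i)" for i
  define D where "D = 8 * (6 + 16 / c\<^sup>2)"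
  have D: "0 \<le> D" by (simp add: D_def)
  have count: "\<forall>\<^sub>F i in sequentially.
      real (card (J i)) * (2 powr (real i * \<alpha>))\<^sup>2 \<le> D * (real i + 1)\<^sup>2 * 2 ^ i * real (K i)"
    unfolding eventually_sequentially
  proof (intro exI allI impI)
    fix i assume i: "N0 \<le> i"
    show "real (card (J i)) * (2 powr (real i * \<alpha>))\<^sup>2 \<le> D * (real i + 1)\<^sup>2 * 2 ^ i * real (K i)"
      unfolding J_def D_def
    proof (rule card_large_cells_le[OF c])
      fix N :: nat assume N: "2 ^ i \<le> N" "N < 2 ^ Suc i"
      \<comment> \<open>Since \<open>i < 2 ^ i \<le> N\<close>, the growth bound valid from
        \<open>N0\<close> on applies as soon as \<open>i \<ge> N0\<close>.\<close>
      have "i < 2 ^ i" by (rule less_exp)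
      with i N have N0: "N0 \<le> N" and Npos: "0 < N" by linarith+
      have "(\<Sum>n=1..N. \<bar>f n\<bar>) \<le> C * real N powr \<tau> * real N"
        using C(2)[OF N0] Npos by (simp add: field_simps)
      also have "\<dots> = C * real N powr \<beta> * real N powr \<alpha>"
        using Npos by (simp add: \<beta>_def mult.assoc flip: powr_add)
                      (simp add: powr_add)
      finally have "4 * pi * (\<Sum>n=1..N. \<bar>f n\<bar>) \<le> 4 * pi * (C * real N powr \<beta> * real N powr \<alpha>)"
        by (intro mult_left_mono) auto
      also have "\<dots> = 4 * pi * C * real N powr \<beta> * real N powr \<alpha>"
        by simp
      also have "\<dots> \<le> real (K i) * real N powr \<alpha>"
      proof (rule mult_right_mono)
        have "real N \<le> real (2 ^ Suc i)"
          using N by (simp only: of_nat_le_iff)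
        then have "real N powr \<beta> \<le> (2 ^ Suc i) powr \<beta>"
          using beta by (intro powr_mono2) auto
        also have "\<dots> = 2 powr \<beta> * 2 powr (real i * \<beta>)"
          by (simp add: powr_mult powr_powr[symmetric] powr_realpow)
        finally have "4 * pi * C * real N powr \<beta> \<le> 4 * pi * C * (2 powr \<beta> * 2 powr (real i * \<beta>))"
          using C(1) by (intro mult_left_mono) auto
        also have "\<dots> \<le> A * 2 powr (real i * \<beta>)"
          by (simp add: A_def algebra_simps)
        also have "\<dots> \<le> real (K i)" by (rule K_lower)
        finally show "4 * pi * C * real N powr \<beta> \<le> real (K i)" .
      qed simp
      finally show "4 * pi * (\<Sum>n=1..N. \<bar>f n\<bar>) \<le> real (K i) * real N powr \<alpha>" .
    qed (use alpha K_pos in auto)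
  qed
  \<comment> \<open>The exponent vanishes at \<open>s = s0\<close> and decreases in
    \<open>s\<close>, so the ratio is below \<open>1\<close> exactly for
    \<open>s > s0\<close>.\<close>
  define r where "r s = 2 powr (1 - 2 * \<alpha> + (1 - s) * \<beta>)" for s
  define b where "b s i = D * (2 * A) powr (1 - s) * ((real i + 1)\<^sup>2 * r s ^ i)" for s i
  have b_nonneg: "0 \<le> b s i" for s i
    using D by (simp add: b_def r_def)
  have b_summable: "summable (b s)" if "s0 < s" for s
  proof -
    have "1 - s < (2 * \<alpha> - 1) / \<beta>"
      using that by (simp add: s0_def)
    then have "(1 - s) * \<beta> < 2 * \<alpha> - 1"
      using beta by (simp add: field_simps)
    then have "r s < 2 powr 0"
      unfolding r_def by (intro powr_less_mono) auto
    then show ?thesis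
      unfolding b_def by (intro summable_mult summable_square_mult_power) (auto simp: r_def)
  qed
  have b_bound: "\<forall>\<^sub>F i in sequentially. real (card (J i)) * (1 / real (K i)) powr s \<le> b s i"
    if "s < 1" for s
    using count
  proof eventually_elim
    case (elim i)
    have "real (card (J i)) \<le> D * (real i + 1)\<^sup>2 * 2 ^ i * real (K i) / (2 powr (real i * \<alpha>))\<^sup>2"
      using elim by (simp add: field_simps)
    also have "\<dots> = D * (real i + 1)\<^sup>2 * 2 powr (real i * (1 - 2 * \<alpha>)) * real (K i)"
      by (simp add: power2_eq_square powr_diff right_diff_distrib powr_realpow flip: powr_add)
         (simp add: mult_ac)
    finally have "real (card (J i)) * (1 / real (K i)) powr s \<le>
        D * (real i + 1)\<^sup>2 * 2 powr (real i * (1 - 2 * \<alpha>)) * real (K i) * (1 / real (K i)) powr s"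
      by (intro mult_right_mono) auto
    also have "\<dots> = D * (real i + 1)\<^sup>2 * 2 powr (real i * (1 - 2 * \<alpha>)) * real (K i) powr (1 - s)"
      using K_pos[of i] by (simp add: powr_diff powr_divide)
    \<comment> \<open>Here \<open>s < 1\<close> makes the power of \<open>K i\<close> increasing, so
      its upper bound may be inserted.\<close>
    also have "\<dots> \<le> D * (real i + 1)\<^sup>2 * 2 powr (real i * (1 - 2 * \<alpha>)) *
        (2 * A * 2 powr (real i * \<beta>)) powr (1 - s)"
      using K_upper[of i] that D by (intro mult_left_mono powr_mono2) auto
    also have "\<dots> = D * (real i + 1)\<^sup>2 * 2 powr (real i * (1 - 2 * \<alpha>)) *
        ((2 * A) powr (1 - s) * 2 powr (real i * \<beta> * (1 - s)))"
      using A by (simp add: powr_mult powr_powr)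
    also have "\<dots> = D * (2 * A) powr (1 - s) * ((real i + 1)\<^sup>2 *
        (2 powr (real i * (1 - 2 * \<alpha>)) * 2 powr (real i * \<beta> * (1 - s))))"
      by (simp only: mult_ac)
    also have "2 powr (real i * (1 - 2 * \<alpha>)) * 2 powr (real i * \<beta> * (1 - s)) = r s ^ i"
      by (simp add: r_def powr_power algebra_simps flip: powr_add)
    finally show ?case by (simp only: b_def)
  qed
  \<comment> \<open>The point \<open>0\<close> lies in every \<open>dyadic_large_set\<close>, so there is always at least one large cell;
    if \<open>s0\<close> were negative, the bound at \<open>s = 0\<close> would force their number to tend to \<open>0\<close>.\<close>
  have "0 \<le> s0"
  proof (rule ccontr)
    assume "\<not> 0 \<le> s0"
    then have "b 0 \<longlonglongrightarrow> 0"
      by (intro summable_LIMSEQ_zero b_summable) simp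
    then have "\<forall>\<^sub>F i in sequentially. b 0 i < 1"
      by (rule order_tendstoD) simp
    then have "\<forall>\<^sub>F i in sequentially. False"
      using b_bound[of 0, OF zero_less_one]
    proof eventually_elim
      case (elim i)
      have "0 \<in> cell (K i) 0" by (simp add: cell_def)
      then have "0 \<in> J i"
        using K_pos[of i] zero_in_dyadic_large_set[of \<alpha> f i] alpha
        by (auto simp: J_def large_cells_def)
      then have "1 \<le> card (J i)"
        using finite_large_cells by (auto simp: J_def Suc_le_eq card_gt_0_iff)
      \<comment> \<open>Positivity of \<open>K i\<close> matters: \<open>x powr 0\<close> is
        \<open>1\<close> for nonzero \<open>x\<close> but \<open>0 powr 0\<close> is
        \<open>0\<close>.\<close>
      with elim K_pos[of i] show ?case by simp
    qed
    then show False by simp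
  qed
  moreover have "hausdorff_measure s (large_sums_set f \<alpha>) = 0" if s: "s0 < s" "s < 1" for s
  proof -
    \<comment> \<open>Empty sets have gauge \<open>0\<close>, so padding with them reduces each
      series to a sum over \<open>J i\<close>.\<close>
    define V where "V i k = (if k \<in> J i then cell (K i) k else {})" for i k
    have diam_cell: "diameter (cell (K i) k) = 1 / real (K i)" for i k
    proof -
      have "real (Suc k) / real (K i) - real k / real (K i) = 1 / real (K i)"
        by (simp add: diff_divide_distrib[symmetric])
      moreover have "0 \<le> 1 / real (K i)" by simp
      ultimately show ?thesis
        unfolding cell_def diameter_closed_interval by (smt (verit))
    qed
    show ?thesis
    proof (rule hausdorff_measure_limsup_eq_0[where V = V and \<delta> = "\<lambda>i. 1 / real (K i)" and b = "b s"])
      fix x assume x: "x \<in> large_sums_set f \<alpha>"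
      have "\<exists>k. x \<in> V i k" if "x \<in> dyadic_large_set f \<alpha> i" for i
      proof -
        have "x \<in> {0..1}" using that by (simp add: dyadic_large_set_def)
        then obtain k where "k < K i" "x \<in> cell (K i) k"
          using cell_cover K_pos by blast
        with that have "x \<in> V i k"
          by (auto simp: V_def J_def large_cells_def)
        then show ?thesis ..
      qed
      then show "\<exists>\<^sub>\<infinity>i. \<exists>k. x \<in> V i k"
        using large_sums_set_limsup[OF x] by (rule INFM_mono[rotated])
    next
      show "bounded (V i k)" for i k by (simp add: V_def cell_def)
      show "diameter (V i k) \<le> 1 / real (K i)" for i k by (simp add: V_def diam_cell)
    next
      have le: "1 / real (K i) \<le> (1 / 2 powr \<beta>) ^ i" for i
      proof -
        have "2 powr (real i * \<beta>) \<le> A * 2 powr (real i * \<beta>)"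
          using A by simp
        also have "\<dots> \<le> real (K i)" by (rule K_lower)
        finally have "1 / real (K i) \<le> 1 / 2 powr (real i * \<beta>)"
          by (intro divide_left_mono) (auto simp: K_pos)
        also have "\<dots> = (1 / 2 powr \<beta>) ^ i"
          by (simp add: power_one_over powr_power mult.commute)
        finally show ?thesis .
      qed
      have "(\<lambda>i. (1 / 2 powr \<beta>) ^ i) \<longlonglongrightarrow> 0"
        using powr_less_mono[OF beta, of 2] by (intro LIMSEQ_power_zero) simp
      then show "(\<lambda>i. 1 / real (K i)) \<longlonglongrightarrow> 0"
        by (rule tendsto_sandwich[OF always_eventually always_eventually tendsto_const, rotated 2])
           (simp_all add: le)
    next
      have "(\<Sum>k. hausdorff_gauge s (V i k)) = ennreal (real (card (J i)) * (1 / real (K i)) powr s)" for i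
      proof -
        have "(\<Sum>k. hausdorff_gauge s (V i k)) = (\<Sum>k\<in>J i. hausdorff_gauge s (V i k))"
          by (intro suminf_finite) (auto simp: J_def finite_large_cells V_def hausdorff_gauge_def)
        also have "\<dots> = (\<Sum>k\<in>J i. ennreal ((1 / real (K i)) powr s))"
        proof (rule sum.cong)
          fix k assume k: "k \<in> J i"
          then have "V i k \<noteq> {}" by (auto simp: V_def J_def large_cells_def)
          \<comment> \<open>Nonnegativity of \<open>s0\<close> gives \<open>s > 0\<close>, which
            selects the power branch of the gauge.\<close>
          then show "hausdorff_gauge s (V i k) = ennreal ((1 / real (K i)) powr s)"
            using s \<open>0 \<le> s0\<close> k by (simp add: hausdorff_gauge_def V_def diam_cell)
        qed simp
        also have "\<dots> = ennreal (real (card (J i)) * (1 / real (K i)) powr s)"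
          by (simp add: ennreal_mult ennreal_of_nat_eq_real_of_nat)
        finally show ?thesis .
      qed
      then show "\<forall>\<^sub>F i in sequentially. (\<Sum>k. hausdorff_gauge s (V i k)) \<le> ennreal (b s i)"
        using b_bound[OF s(2)] by (simp add: ennreal_leI eventually_mono)
    qed (use b_summable[OF s(1)] b_nonneg in auto)
  qed
  ultimately have "hausdorff_dim (large_sums_set f \<alpha>) \<le> ereal s0"
    using hausdorff_dim_le[OF _ s0] by blast
  then show ?thesis by (simp add: s0_def \<beta>_def)
qed

end
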